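(* Let $G=(V,E)$ be the confounding graph with nodes $H,X,Y$ and edges $H\to X$, $H\to Y$, $X\to Y$ together with a self-loop at every node, and let $\alpha=(X\to Y)$. Then the sign of $\alpha$ is partially identifiable with positive measure: both the set of $\Sigma\in\mathcal{M}^{p}_{G,\alpha}$ for which the sign of $\alpha$ is identifiable and the set of $\Sigma\in\mathcal{M}^{p}_{G,\alpha}$ for which the sign of $\alpha$ is non-identifiable have positive Lebesgue measure (in the space of real symmetric $3\times 3$ matrices).
   Context: Let $PD_d$ be the set of symmetric positive definite real $d\times d$ matrices and $PDD_d\subset PD_d$ the set of diagonal ones. $G=(V,E)$ is a finite directed graph with $V=\{V_1,\dots,V_d\}$; cycles and self-loops are allowed. $\operatorname{An}_G(V_i)$ is the set of all $V_k$ from which there is a directed path with at least one edge to $V_i$ (so $V_i\in \operatorname{An}_G(V_i)$ iff $V_i$ lies on a directed cycle, a self-loop counting as a cycle). For $A\in\mathbb{R}^{d\times d}$ the entry $A_{ij}$ corresponds to the edge $e=(V_j,V_i)$, i.e. $V_j\to V_i$, and we write $A_e:=A_{ij}$; $\operatorname{supp}(A)$ is the set of edges $(V_j,V_i)$ with $A_{ij}\neq 0$. The set of $t$-faithful covariance matrices is $$F_G:=\{\Sigma\in PD_d:\ \forall V_i,V_j\in V,\ \operatorname{An}_G(V_i)\cap\operatorname{An}_G(V_j)=\emptyset\iff\Sigma_{ij}=0\}.$$ For $k\in\{+,-\}$, $$\mathcal{M}^{k}_{G,e}:=\{\Sigma\in F_G:\exists A\in\mathbb{R}^{d\times d},\,D\in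 PDD_d \text{ with } A\Sigma+\Sigma A^T=-D,\ \operatorname{supp}(A)=E,\ \operatorname{sign}(A_e)=k\},$$ and $\mathcal{M}^{p}_{G,e}:=\mathcal{M}^{+}_{G,e}\cup\mathcal{M}^{-}_{G,e}$. For $\Sigma\in\mathcal{M}^p_{G,e}$, the sign of $e$ is called non-identifiable for $\Sigma$ if $\Sigma\in\mathcal{M}^{+}_{G,e}\cap\mathcal{M}^{-}_{G,e}$, and identifiable for $\Sigma$ otherwise. *)

theory Defs
  imports "HOL-Analysis.Analysis"
begin

definition PD :: "(real^'n^'n) set" where
  "PD = {S. transpose S = S \<and> (\<forall>x. x \<noteq> 0 \<longrightarrow> 0 < x \<bullet> (S *v x))}"

definition PDD :: "(real^'n^'n) set" where
  "PDD = {D \<in> PD. \<forall>i j. i \<noteq> j \<longrightarrow> D $ i $ j = 0}"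

text \<open>
  A directed graph is given by its edge set \<open>E\<close>; its vertices are all elements of the finite
  type \<open>'n\<close>. The pair \<open>(j, i)\<close> is the edge from \<open>j\<close> to \<open>i\<close>, and belongs to the entry in row \<open>i\<close>,
  column \<open>j\<close> of a matrix.
\<close>

definition An :: "('n \<times> 'n) set \<Rightarrow> 'n \<Rightarrow> 'n set" where
  "An E i = {k. (k, i) \<in> E\<^sup>+}"

definition edge_entry :: "real^'n^'n \<Rightarrow> 'n \<times> 'n \<Rightarrow> real" where
  "edge_entry A e = A $ snd e $ fst e"

definition supp :: "real^'n^'n \<Rightarrow> ('n \<times> 'n) set" where
  "supp A = {e. edge_entry A e \<noteq> 0}"

definition faithful :: "('n \<times> 'n) set \<Rightarrow> (real^'n^'n) set" where
  "faithful E = {S \<in> PD. \<forall>i j. An E i \<inter> An E j = {} \<longleftrightarrow> S $ i $ j = 0}"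

text \<open>The sign \<open>k\<close> is \<open>1\<close> or \<open>-1\<close>.\<close>

definition M_sign :: "real \<Rightarrow> ('n \<times> 'n) set \<Rightarrow> 'n \<times> 'n \<Rightarrow> (real^'n^'n) set" where
  "M_sign k E e = {S \<in> faithful E. \<exists>A D. D \<in> PDD \<and> A ** S + S ** transpose A = - D
      \<and> supp A = E \<and> sgn (edge_entry A e) = k}"

definition M_p :: "('n \<times> 'n) set \<Rightarrow> 'n \<times> 'n \<Rightarrow> (real^'n^'n) set" where
  "M_p E e = M_sign 1 E e \<union> M_sign (-1) E e"

text \<open>The following two notions are meant for \<open>S \<in> M_p E e\<close> only.\<close>

definition sign_nonidentifiable :: "('n \<times> 'n) set \<Rightarrow> 'n \<times> 'n \<Rightarrow> real^'n^'n \<Rightarrow> bool" where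
  "sign_nonidentifiable E e S \<longleftrightarrow> S \<in> M_sign 1 E e \<inter> M_sign (-1) E e"

definition sign_identifiable :: "('n \<times> 'n) set \<Rightarrow> 'n \<times> 'n \<Rightarrow> real^'n^'n \<Rightarrow> bool" where
  "sign_identifiable E e S \<longleftrightarrow> \<not> sign_nonidentifiable E e S"

text \<open>
  Lebesgue measure on the space of symmetric matrices: a symmetric matrix is determined by one
  real coordinate for each unordered pair \<open>{i, j}\<close> of indices (where \<open>i = j\<close> is allowed), namely the
  common value of its entries \<open>(i, j)\<close> and \<open>(j, i)\<close>.
\<close>

definition symmetric_matrices :: "(real^'n^'n) set" where
  "symmetric_matrices = {S. transpose S = S}"

definition unordered_pairs :: "'n set set" where
  "unordered_pairs = {{i, j} |i j. True}"

definition sym_matrix :: "('n set \<Rightarrow> real) \<Rightarrow> real^'n^'n" where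
  "sym_matrix f = (\<chi> i j. f {i, j})"

definition sym_lebesgue :: "(real^'n^'n) measure" where
  "sym_lebesgue = completion (distr (Pi\<^sub>M unordered_pairs (\<lambda>_. lborel))
     (restrict_space borel symmetric_matrices) sym_matrix)"

lemma sym_matrix_measurable:
  "sym_matrix \<in> Pi\<^sub>M unordered_pairs (\<lambda>_. lborel)
     \<rightarrow>\<^sub>M restrict_space borel (symmetric_matrices :: (real^'n^'n) set)"
proof (rule measurable_restrict_space2)
  show "sym_matrix \<in> space (Pi\<^sub>M unordered_pairs (\<lambda>_. lborel)) \<rightarrow> (symmetric_matrices :: (real^'n^'n) set)"
    by (auto simp: symmetric_matrices_def sym_matrix_def transpose_def vec_eq_iff insert_commute)
  have *: "(\<lambda>f. f {i, j}) \<in> borel_measurable (Pi\<^sub>M unordered_pairs (\<lambda>_. lborel))" for i j :: 'n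
  proof -
    have "{i, j} \<in> unordered_pairs"
      by (auto simp: unordered_pairs_def)
    then show ?thesis
      using measurable_component_singleton[of "{i, j}" unordered_pairs "\<lambda>_. lborel :: real measure"]
      by (simp cong: measurable_cong_sets)
  qed
  have b: "(\<lambda>f. sym_matrix f \<bullet> axis i (axis j 1))
      \<in> borel_measurable (Pi\<^sub>M unordered_pairs (\<lambda>_. lborel))" for i j :: 'n
    using *[of i j] by (simp add: inner_axis sym_matrix_def)
  show "sym_matrix \<in> Pi\<^sub>M unordered_pairs (\<lambda>_. lborel) \<rightarrow>\<^sub>M (borel :: (real^'n^'n) measure)"
    by (subst borel_measurable_euclidean_space) (auto simp: Basis_vec_def intro: b)
qed

lemma space_sym_lebesgue: "space sym_lebesgue = symmetric_matrices"
  by (simp add: sym_lebesgue_def space_restrict_space)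

lemma emeasure_sym_lebesgue_box:
  fixes a b :: "'n::finite set \<Rightarrow> real"
  assumes "\<And>e. a e \<le> b e"
  shows "emeasure sym_lebesgue
      {S \<in> symmetric_matrices. \<forall>i j. a {i, j} \<le> S $ i $ j \<and> S $ i $ j \<le> b {i, j}}
    = (\<Prod>e\<in>unordered_pairs. ennreal (b e - a e))"
proof -
  interpret product_sigma_finite "\<lambda>_ :: 'n set. lborel :: real measure" ..
  let ?P = "Pi\<^sub>M (unordered_pairs :: 'n set set) (\<lambda>_. lborel :: real measure)"
  let ?N = "restrict_space borel (symmetric_matrices :: (real^'n^'n) set)"
  let ?B = "{S :: real^'n^'n. \<forall>i j. a {i, j} \<le> S $ i $ j \<and> S $ i $ j \<le> b {i, j}}"
  have "closed ?B"
    by (intro closed_Collect_all closed_Collect_conj closed_Collect_le continuous_intros)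
  then have "symmetric_matrices \<inter> ?B \<in> sets ?N"
    by (auto simp: sets_restrict_space)
  then have s: "{S \<in> symmetric_matrices. S \<in> ?B} \<in> sets ?N"
    by (simp add: Int_def)
  have "emeasure sym_lebesgue {S \<in> symmetric_matrices. S \<in> ?B}
      = emeasure ?P (sym_matrix -` {S \<in> symmetric_matrices. S \<in> ?B} \<inter> space ?P)"
    unfolding sym_lebesgue_def emeasure_distr[OF sym_matrix_measurable s, symmetric]
    using s by (intro emeasure_completion[THEN trans] arg_cong[where f = "emeasure _"] main_part)
      (simp_all only: sets_distr sets_completionI_sets)
  also have "sym_matrix -` {S \<in> symmetric_matrices. S \<in> ?B} \<inter> space ?P
      = (\<Pi>\<^sub>E e\<in>unordered_pairs. {a e..b e})"
  proof -
    have "sym_matrix f \<in> (symmetric_matrices :: (real^'n^'n) set)" for f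
      by (simp add: symmetric_matrices_def sym_matrix_def transpose_def vec_eq_iff insert_commute)
    moreover have "sym_matrix f \<in> ?B \<longleftrightarrow> (\<forall>e\<in>unordered_pairs. a e \<le> f e \<and> f e \<le> b e)" for f
      unfolding sym_matrix_def unordered_pairs_def by auto
    ultimately have "sym_matrix -` {S \<in> symmetric_matrices. S \<in> ?B}
        = {f. \<forall>e\<in>unordered_pairs. a e \<le> f e \<and> f e \<le> b e}"
      by (simp add: vimage_def)
    then show ?thesis
      by (auto simp: space_PiM PiE_iff)
  qed
  also have "emeasure ?P \<dots> = (\<Prod>e\<in>unordered_pairs. ennreal (b e - a e))"
    using assms by (subst emeasure_PiM) auto
  finally show ?thesis by simp
qed

datatype node = H | X | Y

instance node :: finite
proof
  have "(UNIV :: node set) = {H, X, Y}"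
    using node.exhaust by auto
  then show "finite (UNIV :: node set)"
    by (metis finite.emptyI finite.insertI)
qed

definition confounding_graph :: "(node \<times> node) set" where
  "confounding_graph = {(H, X), (H, Y), (X, Y), (H, H), (X, X), (Y, Y)}"

end

theory Submission
  imports Defs
begin

text \<open>
  Write \<open>p, q, r, s, t, u\<close> for the entries \<open>HH, HX, HY, XX, XY, YY\<close> of a covariance matrix \<open>S\<close> and
  \<open>a, b, c, d, e, f\<close> for the entries \<open>HH, XH, XX, YH, YX, YY\<close> of the lower triangular drift matrix \<open>A\<close>.
  The three off-diagonal Lyapunov equations are linear in \<open>b, d, e\<close>, so the self-loops \<open>a, c, f\<close>
  parametrise the solutions, and eliminating \<open>b\<close> and \<open>d\<close> gives (\<open>confounding_effect_formula\<close>)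
  \<open>e (p s - q\<^sup>2) = 2 a q r - (c + f) w\<close> with \<open>w = p t - q r\<close>.

  The self-loops of a solution are negative (\<open>confounding_self_loops_negative\<close>). If \<open>q r < 0 < w\<close>,
  both terms of the formula are therefore positive, and \<open>e > 0\<close> for every solution: the sign is
  identifiable. If \<open>q r\<close> and \<open>w\<close> are both positive, the two terms compete, and which one wins depends
  on the size of \<open>c + f\<close>; a concrete matrix admits solutions with either sign of \<open>e\<close>.

  To pass from one matrix to a set of positive measure, keep \<open>a, c, f\<close> fixed and let \<open>S\<close> vary: the
  unique \<open>b, d, e\<close> depend continuously on \<open>S\<close>, and all remaining conditions are strict
  inequalities or ask that an entry does not vanish. Hence the set of matrices admitting a prescribed sign is relatively open among the
  symmetric matrices (\<open>openin_M_sign_confounding\<close>). This settles measurability, and a nonempty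
  relatively open set contains a box, so it has positive measure
  (\<open>emeasure_sym_lebesgue_openin_pos\<close>).
\<close>

section \<open>Open sets of symmetric matrices have positive measure\<close>

text \<open>
  By homogeneity it suffices to test \<open>x\<close> on the unit sphere, which is compact; so the complement is
  the projection of a closed set along a compact factor.
\<close>

lemma open_positive_forms:
  "open {S :: real^'n^'n. \<forall>x. x \<noteq> 0 \<longrightarrow> 0 < x \<bullet> (S *v x)}"
proof -
  let ?T = "{(x, S :: real^'n^'n). x \<bullet> (S *v x) \<le> 0}"
  have "closed ?T"
    unfolding case_prod_beta matrix_vector_mult_def
    by (intro closed_Collect_le continuous_intros)
  then have "closed {S. \<exists>x. x \<in> sphere 0 1 \<and> (x, S) \<in> ?T}"
    by (intro closed_compact_projection) auto
  moreover have "{S. \<exists>x. x \<in> sphere 0 1 \<and> (x, S) \<in> ?T}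
      = - {S :: real^'n^'n. \<forall>x. x \<noteq> 0 \<longrightarrow> 0 < x \<bullet> (S *v x)}"
  proof -
    have "\<exists>y. y \<in> sphere 0 1 \<and> y \<bullet> (S *v y) \<le> 0" if "x \<noteq> 0" "x \<bullet> (S *v x) \<le> 0"
      for x and S :: "real^'n^'n"
    proof (intro exI conjI)
      let ?y = "(1 / norm x) *\<^sub>R x"
      show "?y \<in> sphere 0 1"
        using that by simp
      have "?y \<bullet> (S *v ?y) = (1 / norm x)\<^sup>2 * (x \<bullet> (S *v x))"
        by (simp add: matrix_vector_mult_scaleR power2_eq_square)
      then show "?y \<bullet> (S *v ?y) \<le> 0"
        using that(2) by (simp add: mult_nonneg_nonpos)
    qed
    moreover have "x \<noteq> 0" if "x \<in> sphere 0 1" for x :: "real^'n"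
      using that by auto
    ultimately have "(\<exists>x. x \<in> sphere 0 1 \<and> x \<bullet> (S *v x) \<le> 0)
        \<longleftrightarrow> \<not> (\<forall>x. x \<noteq> 0 \<longrightarrow> 0 < x \<bullet> (S *v x))" for S :: "real^'n^'n"
      by (metis not_less)
    then show ?thesis
      by auto
  qed
  ultimately show ?thesis
    by (simp add: closed_def)
qed

lemma openin_symmetric_matrices_sets:
  assumes "openin (top_of_set symmetric_matrices) W"
  shows "W \<in> sets sym_lebesgue"
proof -
  obtain U where "open U" "W = symmetric_matrices \<inter> U"
    using assms by (auto simp: openin_open)
  then show ?thesis
    by (auto simp: sym_lebesgue_def sets_restrict_space intro!: sets_completionI_sets)
qed

text \<open>
  A ball around a point of \<open>W\<close> contains a box whose sides are indexed by unordered pairs, and the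
  measure of such a box is the product of its side lengths.
\<close>

lemma emeasure_sym_lebesgue_openin_pos:
  fixes W :: "(real^'n^'n) set"
  assumes "openin (top_of_set symmetric_matrices) W" and "W \<noteq> {}"
  shows "0 < emeasure sym_lebesgue W"
proof -
  obtain S where S: "S \<in> W"
    using assms(2) by auto
  then obtain \<epsilon> where \<epsilon>: "\<epsilon> > 0" "\<And>T. T \<in> symmetric_matrices \<Longrightarrow> dist T S < \<epsilon> \<Longrightarrow> T \<in> W"
    using assms(1) by (auto simp: openin_euclidean_subtopology_iff)
  have sym: "S $ i $ j = S $ j $ i" for i j
    using S openin_imp_subset[OF assms(1)]
    by (auto simp: symmetric_matrices_def transpose_def vec_eq_iff)
  define \<delta> where "\<delta> = \<epsilon> / (2 * real CARD('n) * real CARD('n))"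
  have "\<delta> > 0"
    using \<epsilon> by (simp add: \<delta>_def)
  \<comment> \<open>The common value of the entries \<open>(i, j)\<close> and \<open>(j, i)\<close>, as a function of the pair.\<close>
  define c where "c = (\<lambda>e. SOME v. \<exists>i j. e = {i, j} \<and> v = S $ i $ j)"
  have c: "c {i, j} = S $ i $ j" for i j
    unfolding c_def by (rule some_equality) (auto simp: doubleton_eq_iff sym)
  let ?B = "{T \<in> symmetric_matrices. \<forall>i j. c {i, j} - \<delta> \<le> T $ i $ j \<and> T $ i $ j \<le> c {i, j} + \<delta>}"
  have "0 < (\<Prod>e\<in>(unordered_pairs :: 'n set set). ennreal ((c e + \<delta>) - (c e - \<delta>)))"
    using \<open>\<delta> > 0\<close> by (subst prod_ennreal) (auto intro!: prod_pos)
  also have "\<dots> = emeasure sym_lebesgue ?B"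
    using \<open>\<delta> > 0\<close> by (intro emeasure_sym_lebesgue_box[symmetric]) simp
  also have "\<dots> \<le> emeasure sym_lebesgue W"
  proof (intro emeasure_mono openin_symmetric_matrices_sets assms(1) subsetI)
    fix T assume T: "T \<in> ?B"
    have "dist T S \<le> (\<Sum>i\<in>UNIV. norm ((T - S) $ i))"
      unfolding dist_norm by (subst norm_vec_def) (simp add: L2_set_le_sum)
    also have "\<dots> \<le> (\<Sum>i\<in>UNIV. \<Sum>j\<in>UNIV. \<bar>(T - S) $ i $ j\<bar>)"
      by (intro sum_mono norm_le_l1_cart)
    also have "\<dots> \<le> (\<Sum>i\<in>(UNIV :: 'n set). \<Sum>j\<in>(UNIV :: 'n set). \<delta>)"
      using T by (intro sum_mono) (simp add: c abs_le_iff algebra_simps)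
    also have "\<dots> = \<epsilon> / 2"
      by (simp add: \<delta>_def)
    also have "\<dots> < \<epsilon>"
      using \<epsilon> by simp
    finally show "T \<in> W"
      using \<epsilon> T by auto
  qed
  finally show ?thesis .
qed

section \<open>The equations of the confounding graph\<close>

lemma UNIV_node: "(UNIV :: node set) = {H, X, Y}"
  using node.exhaust by auto

lemma all_node: "(\<forall>i :: node. P i) \<longleftrightarrow> P H \<and> P X \<and> P Y"
  by (metis node.exhaust)

lemma sum_node: "(\<Sum>i\<in>UNIV. g i) = g H + g X + g Y"
  for g :: "node \<Rightarrow> 'a :: comm_monoid_add"
  by (simp add: UNIV_node add.assoc)

definition node_matrix ::
    "real \<Rightarrow> real \<Rightarrow> real \<Rightarrow> real \<Rightarrow> real \<Rightarrow> real \<Rightarrow> real \<Rightarrow> real \<Rightarrow> real \<Rightarrow> real^node^node" where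
  "node_matrix hh hx hy xh xx xy yh yx yy = (\<chi> i j.
     case i of H \<Rightarrow> (case j of H \<Rightarrow> hh | X \<Rightarrow> hx | Y \<Rightarrow> hy)
             | X \<Rightarrow> (case j of H \<Rightarrow> xh | X \<Rightarrow> xx | Y \<Rightarrow> xy)
             | Y \<Rightarrow> (case j of H \<Rightarrow> yh | X \<Rightarrow> yx | Y \<Rightarrow> yy))"

lemma node_matrix_nth [simp]:
  "node_matrix hh hx hy xh xx xy yh yx yy $ H $ H = hh"
  "node_matrix hh hx hy xh xx xy yh yx yy $ H $ X = hx"
  "node_matrix hh hx hy xh xx xy yh yx yy $ H $ Y = hy"
  "node_matrix hh hx hy xh xx xy yh yx yy $ X $ H = xh"
  "node_matrix hh hx hy xh xx xy yh yx yy $ X $ X = xx"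
  "node_matrix hh hx hy xh xx xy yh yx yy $ X $ Y = xy"
  "node_matrix hh hx hy xh xx xy yh yx yy $ Y $ H = yh"
  "node_matrix hh hx hy xh xx xy yh yx yy $ Y $ X = yx"
  "node_matrix hh hx hy xh xx xy yh yx yy $ Y $ Y = yy"
  by (simp_all add: node_matrix_def)

text \<open>\<open>H\<close> has a self-loop and an edge to both other nodes, so it is an ancestor of every node.\<close>

lemma faithful_confounding_iff:
  "S \<in> faithful confounding_graph \<longleftrightarrow> S \<in> PD \<and> (\<forall>i j. S $ i $ j \<noteq> 0)"
proof -
  have "(H, i) \<in> confounding_graph" for i
    by (cases i) (auto simp: confounding_graph_def)
  then have "H \<in> An confounding_graph i" for i
    by (auto simp: An_def)
  then have "An confounding_graph i \<inter> An confounding_graph j \<noteq> {}" for i j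
    by blast
  then show ?thesis
    by (simp add: faithful_def)
qed

lemma supp_confounding_iff:
  "supp A = confounding_graph \<longleftrightarrow>
     A $ H $ X = 0 \<and> A $ H $ Y = 0 \<and> A $ X $ Y = 0 \<and>
     A $ H $ H \<noteq> 0 \<and> A $ X $ H \<noteq> 0 \<and> A $ X $ X \<noteq> 0 \<and>
     A $ Y $ H \<noteq> 0 \<and> A $ Y $ X \<noteq> 0 \<and> A $ Y $ Y \<noteq> 0"
proof -
  have "supp A = confounding_graph \<longleftrightarrow>
      (\<forall>i j. (i, j) \<in> supp A \<longleftrightarrow> (i, j) \<in> confounding_graph)"
    by auto
  then show ?thesis
    by (auto simp: all_node supp_def edge_entry_def confounding_graph_def)
qed

lemma PDD_node_iff:
  fixes D :: "real^node^node"
  shows "D \<in> PDD \<longleftrightarrow> (\<forall>i j. i \<noteq> j \<longrightarrow> D $ i $ j = 0) \<and> (\<forall>i. 0 < D $ i $ i)"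
proof
  assume D: "D \<in> PDD"
  have "0 < axis i 1 \<bullet> (D *v axis i 1)" for i
    using D by (auto simp: PDD_def PD_def)
  then show "(\<forall>i j. i \<noteq> j \<longrightarrow> D $ i $ j = 0) \<and> (\<forall>i. 0 < D $ i $ i)"
    using D by (simp add: PDD_def inner_axis' matrix_vector_mult_basis column_def)
next
  assume D: "(\<forall>i j. i \<noteq> j \<longrightarrow> D $ i $ j = 0) \<and> (\<forall>i. 0 < D $ i $ i)"
  have "0 < x \<bullet> (D *v x)" if "x \<noteq> 0" for x
  proof -
    have "x \<bullet> (D *v x) = (\<Sum>i\<in>UNIV. D $ i $ i * (x $ i)\<^sup>2)"
      using D by (simp add: inner_vec_def matrix_vector_mult_def sum_node power2_eq_square algebra_simps)
    moreover obtain i where "x $ i \<noteq> 0"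
      using \<open>x \<noteq> 0\<close> by (auto simp: vec_eq_iff)
    ultimately show ?thesis
      using D by (auto intro!: sum_pos2[of _ i] mult_nonneg_nonneg simp: less_imp_le)
  qed
  moreover have "transpose D = D"
    using D unfolding vec_eq_iff transpose_def by (simp add: all_node)
  ultimately show "D \<in> PDD"
    using D by (auto simp: PDD_def PD_def)
qed

text \<open>
  The Lyapunov equation for a drift matrix supported on the graph, with rows \<open>(a, 0, 0)\<close>,
  \<open>(b, c, 0)\<close>, \<open>(d, e, f)\<close> in the order \<open>H, X, Y\<close>: three equations for the off-diagonal entries,
  and for the diagonal entries, which are twice the last three expressions, only a sign.
\<close>

definition confounding_solution ::
    "real^node^node \<Rightarrow> real \<Rightarrow> real \<Rightarrow> real \<Rightarrow> real \<Rightarrow> real \<Rightarrow> real \<Rightarrow> bool" where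
  "confounding_solution S a b c d e f \<longleftrightarrow>
     a \<noteq> 0 \<and> b \<noteq> 0 \<and> c \<noteq> 0 \<and> d \<noteq> 0 \<and> e \<noteq> 0 \<and> f \<noteq> 0 \<and>
     b * S$H$H + (a + c) * S$H$X = 0 \<and>
     d * S$H$H + e * S$H$X + (a + f) * S$H$Y = 0 \<and>
     b * S$H$Y + d * S$H$X + e * S$X$X + (c + f) * S$X$Y = 0 \<and>
     a * S$H$H < 0 \<and>
     b * S$H$X + c * S$X$X < 0 \<and>
     d * S$H$Y + e * S$X$Y + f * S$Y$Y < 0"

lemma symmetric_matricesD:
  "S \<in> symmetric_matrices \<Longrightarrow> S $ i $ j = S $ j $ i"
  by (auto simp: symmetric_matrices_def transpose_def vec_eq_iff)

lemma PD_symmetric: "S \<in> PD \<Longrightarrow> S \<in> symmetric_matrices"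
  by (simp add: PD_def symmetric_matrices_def)

lemma M_sign_confounding_iff:
  "S \<in> M_sign k confounding_graph (X, Y) \<longleftrightarrow>
     S \<in> PD \<and> (\<forall>i j. S $ i $ j \<noteq> 0) \<and>
     (\<exists>a b c d e f. confounding_solution S a b c d e f \<and> sgn e = k)"
proof -
  have "(\<exists>A D. D \<in> PDD \<and> A ** S + S ** transpose A = - D
          \<and> supp A = confounding_graph \<and> sgn (edge_entry A (X, Y)) = k)
      \<longleftrightarrow> (\<exists>a b c d e f. confounding_solution S a b c d e f \<and> sgn e = k)" (is "?L \<longleftrightarrow> ?R")
    if "S \<in> PD"
  proof -
    have sym: "S $ X $ H = S $ H $ X" "S $ Y $ H = S $ H $ Y" "S $ Y $ X = S $ X $ Y"
      using symmetric_matricesD[OF PD_symmetric[OF that]] by auto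
    have "?L \<longleftrightarrow> (\<exists>A. - (A ** S + S ** transpose A) \<in> PDD
          \<and> supp A = confounding_graph \<and> sgn (edge_entry A (X, Y)) = k)"
      by (metis add.inverse_inverse)
    also have "\<dots> \<longleftrightarrow> (\<exists>A. A$H$X = 0 \<and> A$H$Y = 0 \<and> A$X$Y = 0 \<and> sgn (A$Y$X) = k \<and>
        confounding_solution S (A$H$H) (A$X$H) (A$X$X) (A$Y$H) (A$Y$X) (A$Y$Y))"
    proof (rule ex_cong1)
      fix A :: "real^node^node"
      let ?M = "A ** S + S ** transpose A"
      have M: "?M $ i $ j = (\<Sum>k\<in>UNIV. A $ i $ k * S $ k $ j) + (\<Sum>k\<in>UNIV. S $ i $ k * A $ j $ k)" for i j
        by (simp add: matrix_matrix_mult_def transpose_def)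
      have entries:
        "?M $ H $ X = A$X$H * S$H$H + (A$H$H + A$X$X) * S$H$X"
        "?M $ X $ H = A$X$H * S$H$H + (A$H$H + A$X$X) * S$H$X"
        "?M $ H $ Y = A$Y$H * S$H$H + A$Y$X * S$H$X + (A$H$H + A$Y$Y) * S$H$Y"
        "?M $ Y $ H = A$Y$H * S$H$H + A$Y$X * S$H$X + (A$H$H + A$Y$Y) * S$H$Y"
        "?M $ X $ Y = A$X$H * S$H$Y + A$Y$H * S$H$X + A$Y$X * S$X$X + (A$X$X + A$Y$Y) * S$X$Y"
        "?M $ Y $ X = A$X$H * S$H$Y + A$Y$H * S$H$X + A$Y$X * S$X$X + (A$X$X + A$Y$Y) * S$X$Y"
        "?M $ H $ H = 2 * (A$H$H * S$H$H)"
        "?M $ X $ X = 2 * (A$X$H * S$H$X + A$X$X * S$X$X)"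
        "?M $ Y $ Y = 2 * (A$Y$H * S$H$Y + A$Y$X * S$X$Y + A$Y$Y * S$Y$Y)"
        if "A$H$X = 0" "A$H$Y = 0" "A$X$Y = 0"
        using that by (simp_all add: M sum_node sym algebra_simps del: vector_add_component)
      have "- ?M \<in> PDD \<longleftrightarrow> (\<forall>i j. i \<noteq> j \<longrightarrow> ?M $ i $ j = 0) \<and> (\<forall>i. ?M $ i $ i < 0)"
        unfolding PDD_node_iff vector_uminus_component neg_equal_0_iff_equal neg_0_less_iff_less ..
      then show "- ?M \<in> PDD \<and> supp A = confounding_graph \<and> sgn (edge_entry A (X, Y)) = k
        \<longleftrightarrow> A$H$X = 0 \<and> A$H$Y = 0 \<and> A$X$Y = 0 \<and> sgn (A$Y$X) = k \<and>
          confounding_solution S (A$H$H) (A$X$H) (A$X$X) (A$Y$H) (A$Y$X) (A$Y$Y)"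
        unfolding supp_confounding_iff edge_entry_def confounding_solution_def
        by (cases "A$H$X = 0 \<and> A$H$Y = 0 \<and> A$X$Y = 0")
          (auto simp: all_node entries simp del: vector_add_component)
    qed
    also have "\<dots> \<longleftrightarrow> ?R"
    proof
      assume ?R
      then obtain a b c d e f where "confounding_solution S a b c d e f" "sgn e = k"
        by blast
      then show "\<exists>A. A$H$X = 0 \<and> A$H$Y = 0 \<and> A$X$Y = 0 \<and> sgn (A$Y$X) = k \<and>
          confounding_solution S (A$H$H) (A$X$H) (A$X$X) (A$Y$H) (A$Y$X) (A$Y$Y)"
        by (intro exI[of _ "node_matrix a 0 0 b c 0 d e f"]) simp
    qed blast
    finally show ?thesis .
  qed
  then show ?thesis
    unfolding M_sign_def mem_Collect_eq faithful_confounding_iff by (metis (no_types, lifting))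
qed

text \<open>
  A leading principal minor arises by evaluating the quadratic form at the vector of cofactors of
  the last row of the leading block: the form is then this minor times the preceding one.
\<close>

lemma PD_minors_pos:
  fixes S :: "real^node^node"
  assumes "S \<in> PD"
  shows "0 < S$H$H" and "0 < S$H$H * S$X$X - (S$H$X)\<^sup>2"
    and "0 < S$H$H * (S$X$X * S$Y$Y - (S$X$Y)\<^sup>2)
          - S$H$X * (S$H$X * S$Y$Y - S$H$Y * S$X$Y)
          + S$H$Y * (S$H$X * S$X$Y - S$H$Y * S$X$X)" (is "0 < ?det")
proof -
  have pos: "0 < x \<bullet> (S *v x)" if "x \<noteq> 0" for x
    using assms that by (simp add: PD_def)
  have sym: "S $ X $ H = S $ H $ X" "S $ Y $ H = S $ H $ Y" "S $ Y $ X = S $ X $ Y"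
    using symmetric_matricesD[OF PD_symmetric[OF assms]] by auto
  show h: "0 < S$H$H"
    using pos[of "axis H 1"] by (simp add: inner_axis' matrix_vector_mult_basis column_def)
  let ?x = "(\<chi> i. case i of H \<Rightarrow> - S$H$X | X \<Rightarrow> S$H$H | Y \<Rightarrow> 0) :: real^node"
  have "?x $ X \<noteq> 0"
    using h by simp
  then have "?x \<noteq> 0"
    by (metis zero_index)
  from pos[OF this] have "0 < S$H$H * (S$H$H * S$X$X - (S$H$X)\<^sup>2)"
    by (simp add: inner_vec_def matrix_vector_mult_def sum_node sym power2_eq_square algebra_simps)
  then show \<Delta>: "0 < S$H$H * S$X$X - (S$H$X)\<^sup>2"
    using h by (simp add: zero_less_mult_iff)
  let ?y = "(\<chi> i. case i of H \<Rightarrow> S$H$X * S$X$Y - S$H$Y * S$X$X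
      | X \<Rightarrow> S$H$X * S$H$Y - S$H$H * S$X$Y
      | Y \<Rightarrow> S$H$H * S$X$X - (S$H$X)\<^sup>2) :: real^node"
  have "?y $ Y \<noteq> 0"
    using \<Delta> by simp
  then have "?y \<noteq> 0"
    by (metis zero_index)
  from pos[OF this] have "0 < ?y \<bullet> (S *v ?y)" .
  moreover have "(S *v ?y) $ H = 0" "(S *v ?y) $ X = 0" "(S *v ?y) $ Y = ?det"
    by (simp_all add: matrix_vector_mult_def sum_node sym power2_eq_square algebra_simps)
  ultimately have "0 < (S$H$H * S$X$X - (S$H$X)\<^sup>2) * ?det"
    by (simp add: inner_vec_def sum_node)
  then show "0 < ?det"
    using \<Delta> by (simp add: zero_less_mult_iff)
qed

text \<open>Substitute \<open>b\<close> and \<open>d\<close> from the first two equations into \<open>p\<close> times the third.\<close>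

lemma confounding_effect_formula:
  assumes "confounding_solution S a b c d e f"
  shows "e * (S$H$H * S$X$X - (S$H$X)\<^sup>2)
    = 2 * a * S$H$X * S$H$Y - (c + f) * (S$H$H * S$X$Y - S$H$X * S$H$Y)"
  using assms unfolding confounding_solution_def by algebra

lemma eventually_nhds_pos:
  fixes g :: "'a::t2_space \<Rightarrow> real"
  assumes "isCont g x" and "0 < g x"
  shows "\<forall>\<^sub>F y in nhds x. 0 < g y"
  using assms by (intro order_tendstoD(1)[of g "g x"]) (simp_all add: isCont_def tendsto_at_iff_tendsto_nhds)

text \<open>
  With the self-loops \<open>a, c, f\<close> kept fixed, the three equations determine the other entries as
  rational functions \<open>B\<close>, \<open>G\<close>, \<open>F\<close> of the covariance matrix. They take the values \<open>b\<close>, \<open>d\<close>, \<open>e\<close> at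
  \<open>S\<close>, so by continuity they keep their signs, and the inequalities remain true, near \<open>S\<close>.
\<close>

lemma confounding_solution_nearby:
  assumes sol: "confounding_solution S a b c d e f"
    and p: "S$H$H \<noteq> 0" and \<Delta>: "S$H$H * S$X$X - (S$H$X)\<^sup>2 \<noteq> 0"
  shows "\<forall>\<^sub>F T in nhds S. \<exists>b d e'. confounding_solution T a b c d e' f \<and> sgn e' = sgn e"
proof -
  define Dt where "Dt = (\<lambda>T :: real^node^node. T$H$H * T$X$X - (T$H$X)\<^sup>2)"
  define B where "B = (\<lambda>T :: real^node^node. - (a + c) * T$H$X / T$H$H)"
  define F where "F = (\<lambda>T :: real^node^node.
    (2 * a * T$H$X * T$H$Y - (c + f) * (T$H$H * T$X$Y - T$H$X * T$H$Y)) / Dt T)"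
  define G where "G = (\<lambda>T :: real^node^node. - (F T * T$H$X + (a + f) * T$H$Y) / T$H$H)"
  have contDt [continuous_intros]: "isCont Dt S"
    unfolding Dt_def by (intro continuous_intros)
  have contB [continuous_intros]: "isCont B S"
    unfolding B_def using p by (intro continuous_intros)
  have contF [continuous_intros]: "isCont F S"
    unfolding F_def using \<Delta> by (intro continuous_intros) (simp add: Dt_def)
  have contG [continuous_intros]: "isCont G S"
    unfolding G_def using p by (intro continuous_intros)
  have BS: "B S = b"
    using sol p by (simp add: B_def confounding_solution_def field_simps)
  have FS: "F S = e"
    using confounding_effect_formula[OF sol] \<Delta> by (simp add: F_def Dt_def field_simps)
  have GS: "G S = d"
    unfolding G_def FS using sol p by (simp add: confounding_solution_def field_simps)
  note sol' = sol[unfolded confounding_solution_def]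
  have "\<forall>\<^sub>F T in nhds S. 0 < (T$H$H)\<^sup>2"
    using p by (intro eventually_nhds_pos continuous_intros) simp
  moreover have "\<forall>\<^sub>F T in nhds S. 0 < (Dt T)\<^sup>2"
    using \<Delta> by (intro eventually_nhds_pos continuous_intros) (simp add: Dt_def)
  moreover have "\<forall>\<^sub>F T in nhds S. 0 < b * B T"
    using sol' by (intro eventually_nhds_pos continuous_intros) (simp add: BS zero_less_mult_iff, linarith)
  moreover have "\<forall>\<^sub>F T in nhds S. 0 < d * G T"
    using sol' by (intro eventually_nhds_pos continuous_intros) (simp add: GS zero_less_mult_iff, linarith)
  moreover have "\<forall>\<^sub>F T in nhds S. 0 < e * F T"
    using sol' by (intro eventually_nhds_pos continuous_intros) (simp add: FS zero_less_mult_iff, linarith)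
  moreover have "\<forall>\<^sub>F T in nhds S. 0 < - (a * T$H$H)"
    using sol' by (intro eventually_nhds_pos continuous_intros) simp
  moreover have "\<forall>\<^sub>F T in nhds S. 0 < - (B T * T$H$X + c * T$X$X)"
    using sol' by (intro eventually_nhds_pos continuous_intros) (simp add: BS)
  moreover have "\<forall>\<^sub>F T in nhds S. 0 < - (G T * T$H$Y + F T * T$X$Y + f * T$Y$Y)"
    using sol' by (intro eventually_nhds_pos continuous_intros) (simp add: GS FS)
  ultimately show ?thesis
  proof eventually_elim
    case (elim T)
    then have T: "T$H$H \<noteq> 0" "Dt T \<noteq> 0"
      by auto
    have hx: "B T * T$H$H + (a + c) * T$H$X = 0"
      using T by (simp add: B_def field_simps)
    have hy: "G T * T$H$H + F T * T$H$X + (a + f) * T$H$Y = 0"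
      using T by (simp add: G_def field_simps)
    have "F T * Dt T = 2 * a * T$H$X * T$H$Y - (c + f) * (T$H$H * T$X$Y - T$H$X * T$H$Y)"
      using T by (simp add: F_def)
    with hx hy have "T$H$H * (B T * T$H$Y + G T * T$H$X + F T * T$X$X + (c + f) * T$X$Y) = 0"
      unfolding Dt_def by algebra
    then have "B T * T$H$Y + G T * T$H$X + F T * T$X$X + (c + f) * T$X$Y = 0"
      using T by simp
    with hx hy have "confounding_solution T a (B T) c (G T) (F T) f"
      using elim sol' unfolding confounding_solution_def by auto
    moreover have "sgn (F T) = sgn e"
      using elim by (auto simp: zero_less_mult_iff)
    ultimately show ?case
      by blast
  qed
qed

text \<open>
  Measurability is not evident from the definition, which projects along \<open>A\<close> and \<open>D\<close>; it follows from
  openness.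
\<close>

lemma openin_M_sign_confounding:
  "openin (top_of_set symmetric_matrices) (M_sign k confounding_graph (X, Y))"
proof (subst openin_subopen, intro ballI)
  fix S assume S: "S \<in> M_sign k confounding_graph (X, Y)"
  then have PD: "S \<in> PD" and nz: "\<And>i j. S $ i $ j \<noteq> 0"
    by (auto simp: M_sign_confounding_iff)
  obtain a b c d e f where sol: "confounding_solution S a b c d e f" and k: "sgn e = k"
    using S by (auto simp: M_sign_confounding_iff)
  have "\<forall>\<^sub>F T in nhds S. \<forall>x. x \<noteq> 0 \<longrightarrow> 0 < x \<bullet> (T *v x)"
    using eventually_nhds_in_open[OF open_positive_forms, of S] PD by (simp add: PD_def)
  moreover have "\<forall>\<^sub>F T in nhds S. \<forall>i\<in>UNIV. \<forall>j\<in>UNIV. 0 < (T $ i $ j)\<^sup>2"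
    using nz by (intro eventually_ball_finite finite ballI eventually_nhds_pos continuous_intros) simp
  moreover have "\<forall>\<^sub>F T in nhds S. \<exists>b d e'. confounding_solution T a b c d e' f \<and> sgn e' = sgn e"
    using PD_minors_pos[OF PD] by (intro confounding_solution_nearby[OF sol]) auto
  ultimately have "\<forall>\<^sub>F T in nhds S. T \<in> symmetric_matrices \<longrightarrow> T \<in> M_sign k confounding_graph (X, Y)"
  proof eventually_elim
    case (elim T)
    then have "T \<in> symmetric_matrices \<Longrightarrow> T \<in> PD" "T $ i $ j \<noteq> 0" for i j
      by (auto simp: PD_def symmetric_matrices_def)
    with elim k show ?case
      unfolding M_sign_confounding_iff by blast
  qed
  then obtain U where "open U" "S \<in> U"
      "\<And>T. T \<in> U \<Longrightarrow> T \<in> symmetric_matrices \<Longrightarrow> T \<in> M_sign k confounding_graph (X, Y)"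
    unfolding eventually_nhds by blast
  with PD show "\<exists>W. openin (top_of_set symmetric_matrices) W \<and> S \<in> W
      \<and> W \<subseteq> M_sign k confounding_graph (X, Y)"
    by (intro exI[of _ "symmetric_matrices \<inter> U"]) (auto simp: PD_symmetric)
qed

section \<open>Identifiability of the sign\<close>

text \<open>
  If \<open>x\<close> is orthogonal to the rows \<open>H\<close> and \<open>X\<close> of \<open>S\<close>, then \<open>S x = \<delta> e\<^sub>Y\<close> for a scalar \<open>\<delta>\<close>, and since
  the column \<open>Y\<close> of \<open>A\<close> is \<open>f e\<^sub>Y\<close>, evaluating the negative definite form \<open>A S + S A\<^sup>T\<close> at \<open>x\<close> gives
  \<open>2 f \<delta> x\<^sub>Y\<close>. For the vector \<open>x\<close> of cofactors of the last row, \<open>\<delta>\<close> is the determinant of \<open>S\<close> and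
  \<open>x\<^sub>Y\<close> the minor of \<open>H, X\<close>, both positive; hence \<open>f < 0\<close>. The argument for \<open>c\<close> is the same in the
  block of \<open>H, X\<close>.
\<close>


lemma confounding_self_loops_negative:
  assumes "S \<in> PD" and "confounding_solution S a b c d e f"
  shows "a < 0" and "c < 0" and "f < 0"
proof -
  let ?p = "S$H$H" and ?q = "S$H$X" and ?r = "S$H$Y"
  let ?s = "S$X$X" and ?t = "S$X$Y" and ?u = "S$Y$Y"
  let ?\<Delta> = "?p * ?s - ?q\<^sup>2"
  let ?det = "?p * (?s * ?u - ?t\<^sup>2) - ?q * (?q * ?u - ?r * ?t) + ?r * (?q * ?t - ?r * ?s)"
  have p: "0 < ?p" and \<Delta>: "0 < ?\<Delta>" and det: "0 < ?det"
    using PD_minors_pos[OF assms(1)] by auto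
  note sol = assms(2)[unfolded confounding_solution_def]
  show "a < 0"
    using sol p by (simp add: mult_less_0_iff)
  have eq: "b * ?p + (a + c) * ?q = 0" "d * ?p + e * ?q + (a + f) * ?r = 0"
      "b * ?r + d * ?q + e * ?s + (c + f) * ?t = 0"
    using sol by auto
  have neg: "a * ?p < 0" "b * ?q + c * ?s < 0" "d * ?r + e * ?t + f * ?u < 0"
    using sol by auto
  have nonpos: "a * ?p * x\<^sup>2 \<le> 0" "(b * ?q + c * ?s) * x\<^sup>2 \<le> 0" for x
    using neg by (simp_all add: mult_nonpos_nonneg less_imp_le)
  have "c * (?p * ?\<Delta>) = (a * ?p) * ?q\<^sup>2 + (b * ?q + c * ?s) * ?p\<^sup>2"
    using eq(1) by algebra
  also have "\<dots> < 0"
    using p by (intro add_nonpos_neg nonpos mult_neg_pos[OF neg(2)]) auto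
  finally show "c < 0"
    using p \<Delta> by (simp add: mult_less_0_iff)
  \<comment> \<open>The right-hand side is half the form at \<open>x\<close>, where the last three terms are its off-diagonal part.\<close>
  have "f * (?\<Delta> * ?det)
      = (a * ?p) * (?q * ?t - ?r * ?s)\<^sup>2 + (b * ?q + c * ?s) * (?q * ?r - ?p * ?t)\<^sup>2
      + (d * ?r + e * ?t + f * ?u) * ?\<Delta>\<^sup>2
      + (b * ?p + (a + c) * ?q) * ((?q * ?t - ?r * ?s) * (?q * ?r - ?p * ?t))
      + (d * ?p + e * ?q + (a + f) * ?r) * ((?q * ?t - ?r * ?s) * ?\<Delta>)
      + (b * ?r + d * ?q + e * ?s + (c + f) * ?t) * ((?q * ?r - ?p * ?t) * ?\<Delta>)"
    by (simp add: power2_eq_square algebra_simps)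
  also have "\<dots> = (a * ?p) * (?q * ?t - ?r * ?s)\<^sup>2 + (b * ?q + c * ?s) * (?q * ?r - ?p * ?t)\<^sup>2
      + (d * ?r + e * ?t + f * ?u) * ?\<Delta>\<^sup>2"
    unfolding eq by simp
  also have "\<dots> < 0"
    using \<Delta> by (intro add_nonpos_neg add_nonpos_nonpos nonpos mult_neg_pos[OF neg(3)]) auto
  finally have "f * (?\<Delta> * ?det) < 0" .
  moreover have "0 < ?\<Delta> * ?det"
    using \<Delta> det by (rule mult_pos_pos)
  ultimately show "f < 0"
    by (metis mult_less_0_iff not_less_iff_gr_or_eq)
qed

lemma confounding_effect_pos:
  assumes "S \<in> PD" and sol: "confounding_solution S a b c d e f"
    and qr: "S$H$X * S$H$Y < 0" and w: "0 < S$H$H * S$X$Y - S$H$X * S$H$Y"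
  shows "0 < e"
proof -
  note neg = confounding_self_loops_negative[OF assms(1) sol]
  have "0 < a * (S$H$X * S$H$Y)"
    using neg(1) qr by (rule mult_neg_neg)
  moreover have "(c + f) * (S$H$H * S$X$Y - S$H$X * S$H$Y) < 0"
    using neg w by (intro mult_neg_pos) auto
  ultimately have "0 < e * (S$H$H * S$X$X - (S$H$X)\<^sup>2)"
    unfolding confounding_effect_formula[OF sol] by (simp add: mult.assoc)
  then show ?thesis
    using PD_minors_pos(2)[OF assms(1)] by (simp add: zero_less_mult_iff)
qed

text \<open>Completing squares diagonalises the form with pivots \<open>1\<close>, \<open>1\<close> and \<open>u - r\<^sup>2 - (t - r)\<^sup>2\<close>.\<close>

lemma node_matrix_PD:
  assumes "r\<^sup>2 + (t - r)\<^sup>2 < u"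
  shows "node_matrix 1 1 r 1 2 t r t u \<in> PD" (is "?S \<in> PD")
proof -
  have "0 < x \<bullet> (?S *v x)" if "x \<noteq> 0" for x
  proof -
    have eq: "x \<bullet> (?S *v x) = (x$H + x$X + r * x$Y)\<^sup>2 + (x$X + (t - r) * x$Y)\<^sup>2
        + (u - (r\<^sup>2 + (t - r)\<^sup>2)) * (x$Y)\<^sup>2"
      by (simp add: inner_vec_def matrix_vector_mult_def sum_node power2_eq_square algebra_simps)
    have nonneg: "0 \<le> (u - (r\<^sup>2 + (t - r)\<^sup>2)) * (x$Y)\<^sup>2"
      using assms by simp
    have "x \<bullet> (?S *v x) \<noteq> 0"
    proof
      assume "x \<bullet> (?S *v x) = 0"
      then have "(x$H + x$X + r * x$Y)\<^sup>2 = 0 \<and> (x$X + (t - r) * x$Y)\<^sup>2 = 0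
          \<and> (u - (r\<^sup>2 + (t - r)\<^sup>2)) * (x$Y)\<^sup>2 = 0"
        unfolding eq using nonneg by (simp add: add_nonneg_eq_0_iff del: mult_eq_0_iff)
      then have "x$Y = 0" "x$X = 0" "x$H = 0"
        using assms by auto
      with that show False
        by (auto simp: vec_eq_iff all_node)
    qed
    moreover have "0 \<le> x \<bullet> (?S *v x)"
      unfolding eq using nonneg by simp
    ultimately show ?thesis
      by simp
  qed
  moreover have "transpose ?S = ?S"
    unfolding vec_eq_iff transpose_def by (simp add: all_node)
  ultimately show ?thesis
    by (simp add: PD_def)
qed

text \<open>Here \<open>q r = -1\<close> and \<open>w = 2\<close>, so this matrix lies in the identifiable region.\<close>

lemma identifiable_witness:
  "node_matrix 1 1 (-1) 1 2 1 (-1) 1 10 \<in> M_sign 1 confounding_graph (X, Y)"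
proof -
  have "confounding_solution (node_matrix 1 1 (-1) 1 2 1 (-1) 1 10) (-1) 3 (-2) (-16) 12 (-3)"
    by (simp add: confounding_solution_def)
  moreover have "sgn (12 :: real) = 1"
    by simp
  moreover have "node_matrix 1 1 (-1) 1 2 1 (-1) 1 10 \<in> PD"
    by (rule node_matrix_PD) simp
  ultimately show ?thesis
    unfolding M_sign_confounding_iff by (intro conjI exI) (assumption | simp add: all_node)+
qed

text \<open>
  Here \<open>q r = 2\<close>, \<open>w = 1\<close> and \<open>p s - q\<^sup>2 = 1\<close>. For \<open>a = -1\<close> and \<open>c = -2\<close> the formula reads \<open>e = -2 - f\<close>,
  which changes sign at \<open>f = -2\<close>; the entry \<open>u = 8\<close> is large enough that the diagonal inequality at
  \<open>Y\<close> holds on both sides, at \<open>f = -1\<close> and \<open>f = -3\<close>.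
\<close>

lemma nonidentifiable_witness:
  "node_matrix 1 1 2 1 2 3 2 3 8
     \<in> M_sign 1 confounding_graph (X, Y) \<inter> M_sign (-1) confounding_graph (X, Y)"
proof -
  have sol: "confounding_solution (node_matrix 1 1 2 1 2 3 2 3 8) (-1) 3 (-2) 7 1 (-3)"
    "confounding_solution (node_matrix 1 1 2 1 2 3 2 3 8) (-1) 3 (-2) 5 (-1) (-1)"
    by (simp_all add: confounding_solution_def)
  have "node_matrix 1 1 2 1 2 3 2 3 8 \<in> PD"
    by (rule node_matrix_PD) simp
  then show ?thesis
    unfolding Int_iff M_sign_confounding_iff
    by (intro conjI exI) (rule sol | simp add: all_node)+
qed

theorem mainTheorem4:
  shows "emeasure sym_lebesgue
           {S \<in> M_p confounding_graph (X, Y). sign_identifiable confounding_graph (X, Y) S} > 0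
       \<and> emeasure sym_lebesgue
           {S \<in> M_p confounding_graph (X, Y). sign_nonidentifiable confounding_graph (X, Y) S} > 0"
proof
  let ?P = "M_sign 1 confounding_graph (X, Y)" and ?N = "M_sign (-1) confounding_graph (X, Y)"
  let ?U = "{S :: real^node^node. S$H$X * S$H$Y < 0 \<and> 0 < S$H$H * S$X$Y - S$H$X * S$H$Y}"
  have "open ?U"
    by (intro open_Collect_conj open_Collect_less continuous_intros)
  then have "openin (top_of_set symmetric_matrices) (?P \<inter> ?U)"
    by (intro openin_Int_open openin_M_sign_confounding)
  moreover have "node_matrix 1 1 (-1) 1 2 1 (-1) 1 10 \<in> ?P \<inter> ?U"
    using identifiable_witness by simp
  ultimately have "0 < emeasure sym_lebesgue (?P \<inter> ?U)"
    by (intro emeasure_sym_lebesgue_openin_pos) auto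
  also have "\<dots> \<le> emeasure sym_lebesgue
      {S \<in> M_p confounding_graph (X, Y). sign_identifiable confounding_graph (X, Y) S}"
  proof (rule emeasure_mono)
    have "S \<notin> ?N" if "S \<in> ?U" for S
    proof
      assume "S \<in> ?N"
      then obtain a b c d e f where "S \<in> PD" "confounding_solution S a b c d e f" "sgn e = -1"
        by (auto simp: M_sign_confounding_iff)
      with confounding_effect_pos[of S] \<open>S \<in> ?U\<close> have "0 < e"
        by auto
      with \<open>sgn e = -1\<close> show False
        by simp
    qed
    then show "?P \<inter> ?U \<subseteq>
        {S \<in> M_p confounding_graph (X, Y). sign_identifiable confounding_graph (X, Y) S}"
      by (auto simp: M_p_def sign_identifiable_def sign_nonidentifiable_def)
    have "{S \<in> M_p confounding_graph (X, Y). sign_identifiable confounding_graph (X, Y) S}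
        = (?P \<union> ?N) - (?P \<inter> ?N)"
      by (auto simp: M_p_def sign_identifiable_def sign_nonidentifiable_def)
    also have "\<dots> \<in> sets sym_lebesgue"
      by (intro sets.Diff sets.Un sets.Int openin_symmetric_matrices_sets openin_M_sign_confounding)
    finally show "{S \<in> M_p confounding_graph (X, Y). sign_identifiable confounding_graph (X, Y) S}
        \<in> sets sym_lebesgue" .
  qed
  finally show "0 < emeasure sym_lebesgue
      {S \<in> M_p confounding_graph (X, Y). sign_identifiable confounding_graph (X, Y) S}" .
  have "{S \<in> M_p confounding_graph (X, Y). sign_nonidentifiable confounding_graph (X, Y) S} = ?P \<inter> ?N"
    by (auto simp: M_p_def sign_nonidentifiable_def)
  moreover have "0 < emeasure sym_lebesgue (?P \<inter> ?N)"
    using nonidentifiable_witness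
    by (intro emeasure_sym_lebesgue_openin_pos openin_Int openin_M_sign_confounding) auto
  ultimately show "0 < emeasure sym_lebesgue
      {S \<in> M_p confounding_graph (X, Y). sign_nonidentifiable confounding_graph (X, Y) S}"
    by simp
qed

end
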